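(* Let $\ell,m \geq 2$ be integers, and let $S$ be a finite set of natural numbers. There is a non-empty $(\ell,m)$-uniform mixed hypergraph $H = (V,\mathcal{C},\mathcal{D})$ with $S(H) = S$ if and only if one of the following holds: (B1) $S = [1,x]$ for some integer $x \geq \ell-1$; or (B2) $\ell = 2$ and $S$ is an arbitrary interval of integers; or (B3) $\ell \geq 3$ and $\min(S) \geq \ell$; or (B4) $\ell \geq 3$ and $\min(S) = a$ for some $a \in [2,\ell-1]$ and $[a,\ell-1]\subseteq S$. Moreover, if $r:S \to \mathbb{N} \setminus \{0\}$ is any function and $S$ is of type (B3) or (B4), then there is such a hypergraph $H$ with $S(H) = S$ and $r_s(H) = r(s)$ for every $s \in S$ with $s \geq \ell$.
   Context: A mixed hypergraph is a triple $H=(V,\mathcal{C},\mathcal{D})$ where $V$ is a finite set of vertices and $\mathcal{C}$, $\mathcal{D}$ are sets of subsets of $V$, called $C$-edges and $D$-edges respectively. It is non-empty if $\mathcal{C}\cup\mathcal{D}\neq\emptyset$. It is $(\ell,m)$-uniform if every $C$-edge has exactly $\ell$ elements and every $D$-edge has exactly $m$ elements. A coloring $c:V\to\mathbb{N}$ is proper if every $C$-edge contains two vertices of the same color (is not rainbow) and every $D$-edge contains two vertices of distinct colors (is not monochromatic). An $s$-coloring is a coloring using exactly $s$ colors. The feasible set $S(H)$ is the set of all $s$ such that $H$ has a proper $s$-coloring. Two colorings are isomorphic if they coincide up to relabeling of colors, and $r_s(H)$ denotes the number of pairwise non-isomorphic proper $s$-colorings of $H$. For integers $i\le j$, $[i,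j]=\{i,i+1,\ldots,j\}$.
   Formalization: H is also required to have at least ℓ-1 vertices (else V={0,1}, no C-edge, one D-edge V, ℓ=4, m=2 gives S={2}, of no type); intervals in (B2) are empty or consist of positive integers, as 0 is never feasible; for ℓ≥3 the empty S counts as type (B3). *)

theory Defs
  imports "HOL-Library.FuncSet"
begin

record 'a mixed_hypergraph =
  verts :: "'a set"
  C_edges :: "'a set set"
  D_edges :: "'a set set"

definition mixed_hypergraph :: "'a mixed_hypergraph \<Rightarrow> bool" where
  "mixed_hypergraph H \<longleftrightarrow>
     finite (verts H) \<and> C_edges H \<subseteq> Pow (verts H) \<and> D_edges H \<subseteq> Pow (verts H)"

definition nonempty :: "'a mixed_hypergraph \<Rightarrow> bool" where
  "nonempty H \<longleftrightarrow> C_edges H \<union> D_edges H \<noteq> {}"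

definition uniform :: "nat \<Rightarrow> nat \<Rightarrow> 'a mixed_hypergraph \<Rightarrow> bool" where
  "uniform l m H \<longleftrightarrow> (\<forall>E\<in>C_edges H. card E = l) \<and> (\<forall>E\<in>D_edges H. card E = m)"

definition proper :: "'a mixed_hypergraph \<Rightarrow> ('a \<Rightarrow> nat) \<Rightarrow> bool" where
  "proper H c \<longleftrightarrow>
     (\<forall>E\<in>C_edges H. \<exists>u\<in>E. \<exists>v\<in>E. u \<noteq> v \<and> c u = c v) \<and>
     (\<forall>E\<in>D_edges H. \<exists>u\<in>E. \<exists>v\<in>E. c u \<noteq> c v)"

(* Colorings are extensional functions, so that two colorings are equal iff they agree on the
   vertices. *)
definition proper_colorings :: "'a mixed_hypergraph \<Rightarrow> nat \<Rightarrow> ('a \<Rightarrow> nat) set" where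
  "proper_colorings H s = {c \<in> verts H \<rightarrow>\<^sub>E UNIV. proper H c \<and> card (c ` verts H) = s}"

definition feasible_set :: "'a mixed_hypergraph \<Rightarrow> nat set" where
  "feasible_set H = {s. proper_colorings H s \<noteq> {}}"

definition isomorphic_colorings :: "'a mixed_hypergraph \<Rightarrow> ('a \<Rightarrow> nat) \<Rightarrow> ('a \<Rightarrow> nat) \<Rightarrow> bool" where
  "isomorphic_colorings H c c' \<longleftrightarrow>
     (\<exists>p. bij_betw p (c ` verts H) (c' ` verts H) \<and> (\<forall>v\<in>verts H. c' v = p (c v)))"

(* There are infinitely many colorings as soon as there is one on a non-empty vertex set (the
   colors are arbitrary naturals), but only finitely many classes, since each class is determined
   by a partition of the finite vertex set; so the cardinality below is never that of an infinite
   set. *)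
definition num_colorings :: "'a mixed_hypergraph \<Rightarrow> nat \<Rightarrow> nat" where
  "num_colorings H s =
     card (proper_colorings H s //
           {(c, c'). c \<in> proper_colorings H s \<and> c' \<in> proper_colorings H s \<and>
                     isomorphic_colorings H c c'})"

definition type_B1 :: "nat \<Rightarrow> nat set \<Rightarrow> bool" where
  "type_B1 l S \<longleftrightarrow> (\<exists>x. l - 1 \<le> x \<and> S = {1..x})"

(* Intervals of positive integers: a non-empty hypergraph without empty edges has a vertex, so 0
   is never feasible. For j < i this is the empty set, which is feasible (uncolorable H). *)
definition type_B2 :: "nat \<Rightarrow> nat set \<Rightarrow> bool" where
  "type_B2 l S \<longleftrightarrow> l = 2 \<and> (\<exists>i j. 1 \<le> i \<and> S = {i..j})"

(* The minimum of the empty set is read as infinity; Min {} is unspecified and has to be avoided. *)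
definition type_B3 :: "nat \<Rightarrow> nat set \<Rightarrow> bool" where
  "type_B3 l S \<longleftrightarrow> 3 \<le> l \<and> (S = {} \<or> l \<le> Min S)"

definition type_B4 :: "nat \<Rightarrow> nat set \<Rightarrow> bool" where
  "type_B4 l S \<longleftrightarrow> 3 \<le> l \<and> S \<noteq> {} \<and> (\<exists>a\<in>{2..l - 1}. Min S = a \<and> {a..l - 1} \<subseteq> S)"

(* Why hypergraphs realising a set should have at least l - 1 vertices: this is automatic if there
   is a C-edge, and if l <= 3. The excluded hypergraphs have no C-edge and fewer than l - 1
   vertices, and no such hypergraph has a feasible set of one of the four types: for example, one
   D-edge {0, 1} on the vertex set {0, 1} is (4, 2)-uniform with feasible set {2}.
   As vertex sets are finite, it is no restriction to take the vertices to be naturals. *)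

end

theory Submission
  imports Defs
begin

text \<open>A coloring with fewer than \<open>l\<close> colours satisfies all C-edges, so its classes may be split until
  there are \<open>l - 1\<close> of them; without D-edges classes may be merged. This gives the necessity of the
  four conditions. For the converse with \<open>l \<ge> 3\<close>, take a blown-up grid with one coordinate of range
  \<open>s\<close> for each \<open>s \<in> S\<close> and each of the \<open>r s\<close> desired colorings, and take as edges all \<open>l\<close>-sets
  that are rainbow in no coordinate and all \<open>m\<close>-sets that are monochromatic in no coordinate. If a
  proper coloring has at least \<open>l\<close> colours, two grid points that differ in the \<open>i\<close>-th coordinate only
  and have distinct colours force every point of a third colour to differ from both in that coordinate;
  so the two slices carry two colours only, and the D-edges between them make each of them
  monochromatic. Hence the coloring is the \<open>i\<close>-th coordinate.\<close>

section \<open>Splitting and merging colour classes\<close>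

text \<open>While there are fewer colours than elements, some class has two elements, and giving one
  of them a fresh colour adds exactly one colour.\<close>

lemma refine_coloring:
  fixes f :: "'a \<Rightarrow> nat"
  assumes "finite V" "card (f ` V) \<le> k" "k \<le> card V"
  obtains g :: "'a \<Rightarrow> nat"
  where "card (g ` V) = k" "\<And>u v. u \<in> V \<Longrightarrow> v \<in> V \<Longrightarrow> g u = g v \<Longrightarrow> f u = f v"
proof -
  have "\<exists>g::'a \<Rightarrow> nat. card (g ` V) = k \<and> (\<forall>u\<in>V. \<forall>v\<in>V. g u = g v \<longrightarrow> f u = f v)"
    using assms(2,3)
  proof (induction k rule: dec_induct)
    case base
    show ?case by (intro exI[of _ f]) auto
  next
    case (step k)
    then obtain g :: "'a \<Rightarrow> nat"
      where g: "card (g ` V) = k" "\<forall>u\<in>V. \<forall>v\<in>V. g u = g v \<longrightarrow> f u = f v"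
      by auto
    have "\<not> inj_on g V"
      using step.prems g(1) card_image[of g V] by auto
    then obtain u v where uv: "u \<in> V" "v \<in> V" "u \<noteq> v" "g u = g v"
      by (auto simp: inj_on_def)
    obtain t where t: "t \<notin> g ` V"
      using ex_new_if_finite[of "g ` V"] assms(1) by auto
    have "(g(u := t)) ` V = insert t (g ` V)"
    proof -
      have "g u \<in> g ` (V - {u})" using uv by force
      then have "g ` (V - {u}) = g ` V" using uv by auto
      moreover have "(g(u := t)) ` V = insert t (g ` (V - {u}))"
        using uv by auto
      ultimately show ?thesis by simp
    qed
    then have "card ((g(u := t)) ` V) = Suc k"
      using t g(1) assms(1) by simp
    moreover have "\<forall>a\<in>V. \<forall>b\<in>V. (g(u := t)) a = (g(u := t)) b \<longrightarrow> f a = f b"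
    proof (intro ballI impI)
      fix a b assume ab: "a \<in> V" "b \<in> V" "(g(u := t)) a = (g(u := t)) b"
      then have "g a \<noteq> t" "g b \<noteq> t" using t by auto
      then have "g a = g b" using ab(3) by (simp split: if_splits)
      then show "f a = f b" using g(2) ab by blast
    qed
    ultimately show ?case by blast
  qed
  then show thesis using that by blast
qed

text \<open>Number the colours from 0 and cap the numbers at \<open>k - 1\<close>; this merges all
  classes from that number on.\<close>

lemma coarsen_coloring:
  fixes f :: "'a \<Rightarrow> nat"
  assumes "finite V" "1 \<le> k" "k \<le> card (f ` V)"
  obtains g :: "'a \<Rightarrow> nat"
  where "card (g ` V) = k" "\<And>u v. f u = f v \<Longrightarrow> g u = g v"
proof -
  obtain h where h: "bij_betw h (f ` V) {0..<card (f ` V)}"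
    using ex_bij_betw_finite_nat assms(1) by blast
  define g where "g v = min (h (f v)) (k - 1)" for v
  have hV: "h ` f ` V = {0..<card (f ` V)}"
    using h by (simp add: bij_betw_def)
  have "g ` V = (\<lambda>t. min t (k - 1)) ` (h ` f ` V)"
    unfolding g_def by (simp add: image_image)
  also have "\<dots> = {0..<k}"
  proof
    show "(\<lambda>t. min t (k - 1)) ` (h ` f ` V) \<subseteq> {0..<k}" using assms(2) by auto
    show "{0..<k} \<subseteq> (\<lambda>t. min t (k - 1)) ` (h ` f ` V)"
    proof
      fix t assume "t \<in> {0..<k}"
      then have "t = min t (k - 1)" "t \<in> h ` f ` V" using assms(3) unfolding hV by auto
      then show "t \<in> (\<lambda>t. min t (k - 1)) ` (h ` f ` V)" by blast
    qed
  qed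
  finally have "card (g ` V) = k" by simp
  then show thesis using that[of g] by (simp add: g_def)
qed

section \<open>Proper colorings\<close>

lemma proper_cong:
  assumes "mixed_hypergraph H" "\<And>v. v \<in> verts H \<Longrightarrow> c v = c' v"
  shows "proper H c \<longleftrightarrow> proper H c'"
proof -
  have "\<And>E v. E \<in> C_edges H \<union> D_edges H \<Longrightarrow> v \<in> E \<Longrightarrow> c v = c' v"
    using assms unfolding mixed_hypergraph_def by blast
  then have "\<forall>E\<in>C_edges H \<union> D_edges H. \<forall>u\<in>E. \<forall>v\<in>E. c u = c v \<longleftrightarrow> c' u = c' v" by metis
  then show ?thesis unfolding proper_def by (intro conj_cong ball_cong bex_cong) auto
qed

text \<open>Admits colorings given by arbitrary functions: restricting them to the vertices affects
  neither properness nor the number of colours.\<close>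

lemma feasible_setI:
  assumes "mixed_hypergraph H" "proper H c" "card (c ` verts H) = s"
  shows "s \<in> feasible_set H"
proof -
  have "restrict c (verts H) \<in> proper_colorings H s"
    using assms proper_cong[of H c "restrict c (verts H)"]
    by (auto simp: proper_colorings_def)
  then show ?thesis by (auto simp: feasible_set_def)
qed

lemma feasible_setD:
  assumes "s \<in> feasible_set H"
  shows "\<exists>c. proper H c \<and> card (c ` verts H) = s"
  using assms by (auto simp: feasible_set_def proper_colorings_def)

text \<open>In terms of partitions, isomorphism is visibly an equivalence relation, and no
  relabeling has to be exhibited later.\<close>

lemma isomorphic_colorings_iff:
  "isomorphic_colorings H c c' \<longleftrightarrow>
    (\<forall>u\<in>verts H. \<forall>v\<in>verts H. c u = c v \<longleftrightarrow> c' u = c' v)"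
proof
  assume "isomorphic_colorings H c c'"
  then obtain p where p: "bij_betw p (c ` verts H) (c' ` verts H)"
    "\<And>v. v \<in> verts H \<Longrightarrow> c' v = p (c v)"
    by (auto simp: isomorphic_colorings_def)
  have "inj_on p (c ` verts H)" using p(1) by (simp add: bij_betw_def)
  then show "\<forall>u\<in>verts H. \<forall>v\<in>verts H. c u = c v \<longleftrightarrow> c' u = c' v"
    using p(2) by (simp add: inj_on_eq_iff)
next
  assume eq: "\<forall>u\<in>verts H. \<forall>v\<in>verts H. c u = c v \<longleftrightarrow> c' u = c' v"
  \<comment> \<open>To translate a colour of \<open>c\<close>, pick any vertex that has it and read
    off \<open>c'\<close>; by \<open>eq\<close> the choice does not matter.\<close>
  define p where "p = c' \<circ> inv_into (verts H) c"
  have p: "p (c v) = c' v" if "v \<in> verts H" for v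
    using eq that inv_into_into[of "c v" c "verts H"] f_inv_into_f[of "c v" c "verts H"]
    unfolding p_def comp_def by blast
  have "inj_on p (c ` verts H)" using p eq by (intro inj_onI) (metis imageE)
  moreover have "p ` c ` verts H = c' ` verts H" using p by (simp add: image_image)
  ultimately show "isomorphic_colorings H c c'"
    unfolding isomorphic_colorings_def bij_betw_def using p by metis
qed

lemma isomorphic_colorings_card:
  "isomorphic_colorings H c c' \<Longrightarrow> card (c ` verts H) = card (c' ` verts H)"
  unfolding isomorphic_colorings_def using bij_betw_same_card by blast

section \<open>Necessary conditions on feasible sets\<close>

lemma feasible_pos:
  assumes "mixed_hypergraph H" "nonempty H" "uniform l m H" "2 \<le> l" "2 \<le> m"
    "s \<in> feasible_set H"
  shows "1 \<le> s"
proof -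
  obtain E where "E \<in> C_edges H \<union> D_edges H" using assms(2) by (auto simp: nonempty_def)
  then have "E \<noteq> {}" "E \<subseteq> verts H" using assms by (auto simp: uniform_def mixed_hypergraph_def)
  then have "verts H \<noteq> {}" by auto
  moreover have "finite (verts H)" using assms(1) by (simp add: mixed_hypergraph_def)
  moreover obtain c where "proper H c" "card (c ` verts H) = s" using feasible_setD[OF assms(6)] by blast
  ultimately show ?thesis by (auto simp: Suc_le_eq card_gt_0_iff)
qed

text \<open>With fewer than \<open>l\<close> colours no \<open>l\<close>-set is rainbow, so only the D-edges matter, and these
  survive the splitting of colour classes.\<close>

lemma feasible_below_l:
  assumes H: "mixed_hypergraph H" "uniform l m H" "l - 1 \<le> card (verts H)"
    and "a \<in> feasible_set H" "a \<le> k" "k < l"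
  shows "k \<in> feasible_set H"
proof -
  obtain c where c: "proper H c" "card (c ` verts H) = a" using feasible_setD[OF assms(4)] by blast
  have fin: "finite (verts H)" using H by (simp add: mixed_hypergraph_def)
  have "card (c ` verts H) \<le> k" "k \<le> card (verts H)" using c assms by auto
  then obtain g :: "'a \<Rightarrow> nat" where g: "card (g ` verts H) = k"
    "\<And>u v. u \<in> verts H \<Longrightarrow> v \<in> verts H \<Longrightarrow> g u = g v \<Longrightarrow> c u = c v"
    using refine_coloring[OF fin] by blast
  have "proper H g"
    unfolding proper_def
  proof (intro conjI ballI)
    fix E assume E: "E \<in> C_edges H"
    have "E \<subseteq> verts H" "card E = l" using E H by (auto simp: mixed_hypergraph_def uniform_def)
    then have "card (g ` E) < card E"
      using g(1) \<open>k < l\<close> fin card_mono[of "g ` verts H" "g ` E"] by (auto simp: image_mono)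
    then have "\<not> inj_on g E" using card_image by fastforce
    then show "\<exists>u\<in>E. \<exists>v\<in>E. u \<noteq> v \<and> g u = g v" by (auto simp: inj_on_def)
  next
    fix E assume E: "E \<in> D_edges H"
    then have "E \<subseteq> verts H" using H by (auto simp: mixed_hypergraph_def)
    moreover obtain u v where "u \<in> E" "v \<in> E" "c u \<noteq> c v" using E c by (auto simp: proper_def)
    ultimately show "\<exists>u\<in>E. \<exists>v\<in>E. g u \<noteq> g v" using g(2) by blast
  qed
  then show ?thesis using feasible_setI H(1) g(1) by blast
qed

text \<open>A coloring with one colour excludes D-edges. Then merging classes keeps colorings
  proper, so \<open>S\<close> is closed downwards to 1, while splitting classes reaches
  \<open>l - 1\<close>.\<close>

lemma feasible_one_type_B1:
  assumes H: "mixed_hypergraph H" "nonempty H" "uniform l m H" "l - 1 \<le> card (verts H)"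
    and l: "2 \<le> l" and m: "2 \<le> m"
    and S: "feasible_set H = S" "finite S" "1 \<in> S"
  shows "type_B1 l S"
proof -
  have fin: "finite (verts H)" using H by (simp add: mixed_hypergraph_def)
  obtain c where c: "proper H c" "card (c ` verts H) = 1" using feasible_setD[of 1 H] S by auto
  have noD: "D_edges H = {}"
  proof (rule ccontr)
    assume "D_edges H \<noteq> {}"
    then obtain E where E: "E \<in> D_edges H" by auto
    then obtain u v where "u \<in> E" "v \<in> E" "c u \<noteq> c v" using c by (auto simp: proper_def)
    moreover have "E \<subseteq> verts H" using E H by (auto simp: mixed_hypergraph_def)
    moreover obtain p where "c ` verts H = {p}" using c(2) by (rule card_1_singletonE)
    ultimately have "c u = p" "c v = p" by auto
    then show False using \<open>c u \<noteq> c v\<close> by simp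
  qed
  have down: "k \<in> S" if k: "s \<in> S" "1 \<le> k" "k \<le> s" for s k
  proof -
    obtain c where c: "proper H c" "card (c ` verts H) = s" using feasible_setD[of s H] S k by auto
    obtain g :: "'a \<Rightarrow> nat" where g: "card (g ` verts H) = k" "\<And>u v. c u = c v \<Longrightarrow> g u = g v"
      using coarsen_coloring[OF fin k(2), of c] k(3) c(2) by blast
    have "proper H g" using c(1) noD g(2) unfolding proper_def by fast
    then show ?thesis using feasible_setI H(1) g(1) S(1) by blast
  qed
  have "l - 1 \<in> S" using feasible_below_l[OF H(1,3,4), of 1 "l - 1"] S l by auto
  then have "l - 1 \<le> Max S" using S by simp
  moreover have "S = {1..Max S}"
  proof
    show "S \<subseteq> {1..Max S}" using feasible_pos[OF H(1-3) l m] S by auto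
    have "Max S \<in> S" using S by (intro Max_in) auto
    then show "{1..Max S} \<subseteq> S" using down by auto
  qed
  ultimately show ?thesis unfolding type_B1_def by blast
qed

text \<open>For \<open>l = 2\<close>, C-edges are identifications of vertices; a coloring in between is found on the
  quotient by the common refinement of two given colorings.\<close>

lemma feasible_type_B2:
  assumes H: "mixed_hypergraph H" "nonempty H" "uniform 2 m H" and m: "2 \<le> m"
    and S: "feasible_set H = S" "finite S"
  shows "type_B2 2 S"
proof (cases "S = {}")
  case True
  then show ?thesis unfolding type_B2_def by (intro conjI exI[of _ 1] exI[of _ 0]) auto
next
  case False
  have fin: "finite (verts H)" using H by (simp add: mixed_hypergraph_def)
  have betw: "k \<in> S" if k: "i \<in> S" "j \<in> S" "i \<le> k" "k \<le> j" for i j k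
  proof -
    obtain c where c: "proper H c" "card (c ` verts H) = i" using feasible_setD[of i H] S k by auto
    obtain d where d: "proper H d" "card (d ` verts H) = j" using feasible_setD[of j H] S k by auto
    \<comment> \<open>\<open>W\<close> indexes the classes of the common refinement. It projects
      onto the colours of \<open>d\<close>, so it has at least \<open>k\<close> elements, and the
      classes of \<open>c\<close> can be split within it. The result \<open>e\<close> refines
      \<open>c\<close>, which serves the D-edges, and is constant wherever \<open>c\<close> and
      \<open>d\<close> both are, which serves the C-edges.\<close>
    define W where "W = (\<lambda>v. (c v, d v)) ` verts H"
    have W: "finite W" "fst ` W = c ` verts H" "snd ` W = d ` verts H"
      unfolding W_def using fin by (auto simp: image_image)
    have "card (fst ` W) \<le> k" "k \<le> card W"
      using c d k W card_image_le[of W snd] by auto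
    then obtain g :: "nat \<times> nat \<Rightarrow> nat" where g: "card (g ` W) = k"
      "\<And>u v. u \<in> W \<Longrightarrow> v \<in> W \<Longrightarrow> g u = g v \<Longrightarrow> fst u = fst v"
      using refine_coloring[OF W(1)] by blast
    define e where "e v = g (c v, d v)" for v
    have "proper H e"
      unfolding proper_def
    proof (intro conjI ballI)
      fix E assume E: "E \<in> C_edges H"
      then have "card E = 2" using H by (auto simp: uniform_def)
      then obtain u v where uv: "E = {u, v}" "u \<noteq> v" by (meson card_2_iff)
      then have "c u = c v" "d u = d v"
        using E c(1) d(1) unfolding proper_def by (metis insert_iff singletonD)+
      then show "\<exists>u\<in>E. \<exists>v\<in>E. u \<noteq> v \<and> e u = e v" using uv by (auto simp: e_def)
    next
      fix E assume E: "E \<in> D_edges H"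
      then have "E \<subseteq> verts H" using H by (auto simp: mixed_hypergraph_def)
      moreover obtain u v where uv: "u \<in> E" "v \<in> E" "c u \<noteq> c v"
        using E c by (auto simp: proper_def)
      ultimately have "(c u, d u) \<in> W" "(c v, d v) \<in> W" by (auto simp: W_def)
      then have "e u \<noteq> e v" using g(2)[of "(c u, d u)" "(c v, d v)"] uv(3) by (auto simp: e_def)
      then show "\<exists>u\<in>E. \<exists>v\<in>E. e u \<noteq> e v" using uv by blast
    qed
    moreover have "card (e ` verts H) = k"
      using g(1) by (simp add: W_def e_def image_image)
    ultimately show ?thesis using feasible_setI H(1) S(1) by blast
  qed
  have "S = {Min S..Max S}"
  proof
    show "S \<subseteq> {Min S..Max S}" using S(2) by auto
    have "Min S \<in> S" "Max S \<in> S" using S(2) False by simp_all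
    then show "{Min S..Max S} \<subseteq> S" using betw by (meson atLeastAtMost_iff subsetI)
  qed
  moreover have "1 \<le> Min S"
    using feasible_pos[OF H(1-3) _ m] S Min_in[OF S(2) False] by auto
  ultimately show ?thesis unfolding type_B2_def by blast
qed

section \<open>Intervals\<close>

text \<open>If every C-edge contains 0 and 1, one common colour for these two satisfies all of them
  and leaves up to \<open>x\<close> colours on \<open>x + 1\<close> vertices. Since
  \<open>l - 1 <= x\<close>, there is such an edge, which excludes \<open>x + 1\<close>
  colours.\<close>

lemma ex_type_B1:
  assumes l: "2 \<le> l" and S: "type_B1 l S"
  shows "\<exists>H :: nat mixed_hypergraph. mixed_hypergraph H \<and> nonempty H \<and> uniform l m H \<and>
    l - 1 \<le> card (verts H) \<and> feasible_set H = S"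
proof -
  obtain x where x: "l - 1 \<le> x" "S = {1..x}" using S by (auto simp: type_B1_def)
  define H :: "nat mixed_hypergraph" where
    "H = \<lparr>verts = {..x}, C_edges = {E. E \<subseteq> {..x} \<and> card E = l \<and> {0, 1} \<subseteq> E}, D_edges = {}\<rparr>"
  have mH: "mixed_hypergraph H" by (auto simp: H_def mixed_hypergraph_def)
  have "{0, 1} \<subseteq> {..x}" "card {0, 1::nat} \<le> l" "l \<le> card {..x}" using x l by auto
  then obtain E where E: "{0, 1} \<subseteq> E" "E \<subseteq> {..x}" "card E = l"
    using exists_subset_between[of "{0, 1}" l "{..x}"] by auto
  then have EC: "E \<in> C_edges H" by (simp add: H_def)
  then have ne: "nonempty H" by (auto simp: nonempty_def)
  have "feasible_set H = {1..x}"
  proof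
    show "feasible_set H \<subseteq> {1..x}"
    proof
      fix s assume s: "s \<in> feasible_set H"
      obtain c where c: "proper H c" "card (c ` {..x}) = s"
        using feasible_setD[OF s] by (auto simp: H_def)
      obtain u v where "u \<in> E" "v \<in> E" "u \<noteq> v" "c u = c v"
        using c(1) EC unfolding proper_def by blast
      then have "\<not> inj_on c {..x}" using E by (auto simp: inj_on_def)
      then have "s \<noteq> Suc x" using c(2) eq_card_imp_inj_on[of "{..x}" c] by auto
      moreover have "s \<le> Suc x" using c(2) card_image_le[of "{..x}" c] by auto
      moreover have "0 < s" using c(2) by (auto simp: card_gt_0_iff)
      ultimately show "s \<in> {1..x}" by auto
    qed
    show "{1..x} \<subseteq> feasible_set H"
    proof
      fix k assume k: "k \<in> {1..x}"
      \<comment> \<open>Truncated subtraction gives 0 and 1 the same colour.\<close>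
      define c where "c v = min (v - 1) (k - 1)" for v :: nat
      have "c ` {..x} = {..<k}"
      proof
        show "c ` {..x} \<subseteq> {..<k}" using k by (auto simp: c_def)
        show "{..<k} \<subseteq> c ` {..x}"
        proof
          fix t assume "t \<in> {..<k}"
          then have "t = c (Suc t)" "Suc t \<in> {..x}" using k by (auto simp: c_def)
          then show "t \<in> c ` {..x}" by blast
        qed
      qed
      moreover have "c 0 = c 1" by (simp add: c_def)
      then have "proper H c" unfolding proper_def H_def
        using zero_neq_one[where ?'a = nat] by (simp, blast)
      ultimately show "k \<in> feasible_set H" by (intro feasible_setI[OF mH]) (auto simp: H_def)
    qed
  qed
  then show ?thesis using mH ne x l by (intro exI[of _ H]) (auto simp: H_def uniform_def)
qed

text \<open>The D-edge requires two vertices of distinct colours, but every pair of vertices is a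
  C-edge.\<close>

lemma ex_uncolorable_2:
  assumes m: "2 \<le> m"
  shows "\<exists>H :: nat mixed_hypergraph. mixed_hypergraph H \<and> nonempty H \<and> uniform 2 m H \<and>
    1 \<le> card (verts H) \<and> feasible_set H = {}"
proof -
  define H :: "nat mixed_hypergraph" where
    "H = \<lparr>verts = {..<m}, C_edges = {E. E \<subseteq> {..<m} \<and> card E = 2}, D_edges = {{..<m}}\<rparr>"
  have "\<not> proper H c" for c
  proof
    assume c: "proper H c"
    then obtain u v where uv: "u < m" "v < m" "c u \<noteq> c v" by (auto simp: proper_def H_def)
    then have "{u, v} \<in> C_edges H" by (auto simp: H_def card_2_iff)
    then obtain a b where "a \<in> {u, v}" "b \<in> {u, v}" "a \<noteq> b" "c a = c b"
      using c unfolding proper_def by blast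
    then show False using uv by auto
  qed
  then have "feasible_set H = {}" by (auto dest: feasible_setD)
  then show ?thesis using m
    by (intro exI[of _ H]) (auto simp: H_def mixed_hypergraph_def nonempty_def uniform_def)
qed

text \<open>The C-edges glue the blocks \<open>{t * m..<t * m + m}\<close>, \<open>t < j\<close>, and the D-edges separate the
  first \<open>i\<close> of them.\<close>

lemma ex_type_B2:
  assumes m: "2 \<le> m" and S: "type_B2 2 S"
  shows "\<exists>H :: nat mixed_hypergraph. mixed_hypergraph H \<and> nonempty H \<and> uniform 2 m H \<and>
    1 \<le> card (verts H) \<and> feasible_set H = S"
proof (cases "S = {}")
  case True
  then show ?thesis using ex_uncolorable_2[OF m] by simp
next
  case False
  then obtain i j where ij: "1 \<le> i" "i \<le> j" "S = {i..j}" using S by (auto simp: type_B2_def)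
  define V where "V = {..<j * m}"
  define b where "b v = v div m" for v :: nat
  define H :: "nat mixed_hypergraph" where
    "H = \<lparr>verts = V, C_edges = {E. E \<subseteq> V \<and> card E = 2 \<and> (\<forall>u\<in>E. \<forall>v\<in>E. b u = b v)},
      D_edges = {E. E \<subseteq> V \<and> card E = m \<and> (\<exists>u\<in>E. \<exists>v\<in>E. b u < i \<and> b v < i \<and> b u \<noteq> b v)}\<rparr>"
  have mH: "mixed_hypergraph H" by (auto simp: H_def V_def mixed_hypergraph_def)
  have j0: "m \<le> j * m" using ij by simp
  have b_lt: "b v < j" if "v \<in> V" for v
    using that m by (simp add: V_def b_def less_mult_imp_div_less)
  have tm: "t * m \<in> V" "b (t * m) = t" if "t < j" for t
    using that m by (auto simp: V_def b_def)
  have bV: "b ` V = {..<j}" using b_lt tm by (force simp: image_iff)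
  have "1 < j * m" using j0 m by linarith
  then have "{0, 1} \<in> C_edges H" using m ij by (auto simp: H_def V_def b_def)
  then have ne: "nonempty H" by (auto simp: nonempty_def)
  have "feasible_set H = {i..j}"
  proof
    show "feasible_set H \<subseteq> {i..j}"
    proof
      fix s assume s: "s \<in> feasible_set H"
      obtain c where c: "proper H c" "card (c ` V) = s"
        using feasible_setD[OF s] by (auto simp: H_def)
      have cb: "c u = c v" if "u \<in> V" "v \<in> V" "b u = b v" for u v
      proof (rule ccontr)
        assume ne: "c u \<noteq> c v"
        then have "{u, v} \<in> C_edges H" using that by (auto simp: H_def card_2_iff)
        then obtain x y where "x \<in> {u, v}" "y \<in> {u, v}" "x \<noteq> y" "c x = c y"
          using c unfolding proper_def by blast
        then show False using ne by auto
      qed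
      have "c ` V = (\<lambda>t. c (t * m)) ` {..<j}"
        unfolding bV[symmetric] image_image
      proof (rule image_cong[OF refl])
        fix v assume "v \<in> V"
        then show "c v = c (b v * m)" using tm[OF b_lt] by (intro cb) simp_all
      qed
      then have "s \<le> j" using c(2) card_image_le[of "{..<j}" "\<lambda>t. c (t * m)"] by simp
      have "inj_on (\<lambda>t. c (t * m)) {..<i}"
      proof (rule inj_onI, rule ccontr)
        fix t t' assume t: "t \<in> {..<i}" "t' \<in> {..<i}" "c (t * m) = c (t' * m)" "t \<noteq> t'"
        \<comment> \<open>The block of \<open>t'\<close> alone has \<open>m\<close> vertices, all of
          the colour of \<open>t' * m\<close>. Once \<open>t * m\<close> is added, some
          \<open>m\<close>-set meets both blocks and is a monochromatic D-edge.\<close>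
        let ?W = "insert (t * m) {t' * m..<t' * m + m}"
        have WV: "?W \<subseteq> V"
        proof -
          have "Suc t' * m \<le> j * m" using t ij by (intro mult_le_mono1) auto
          then show ?thesis using t ij tm(1)[of t] by (auto simp: V_def)
        qed
        have bW: "b v = t'" if "v \<in> {t' * m..<t' * m + m}" for v
          using that m unfolding b_def by (auto intro!: div_nat_eqI simp: mult.commute)
        have cW: "c v = c (t' * m)" if "v \<in> ?W" for v
          using that bW[of v] WV t tm[of t'] ij cb[of v "t' * m"] by auto
        have "card {t * m, t' * m} \<le> 2" by (simp add: card_insert_if)
        moreover have "m \<le> card ?W"
          using card_mono[of ?W "{t' * m..<t' * m + m}"] by auto
        ultimately obtain E where E: "{t * m, t' * m} \<subseteq> E" "E \<subseteq> ?W" "card E = m"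
          using exists_subset_between[of "{t * m, t' * m}" m ?W] m by auto
        moreover have "b (t * m) < i" "b (t' * m) < i" "b (t * m) \<noteq> b (t' * m)"
          using t tm(2)[of t] tm(2)[of t'] ij by auto
        ultimately have "\<exists>u\<in>E. \<exists>v\<in>E. b u < i \<and> b v < i \<and> b u \<noteq> b v" by blast
        then have "E \<in> D_edges H" using E WV by (auto simp: H_def)
        then obtain u v where "u \<in> E" "v \<in> E" "c u \<noteq> c v" using c unfolding proper_def by blast
        moreover have "c w = c (t' * m)" if "w \<in> E" for w using cW E(2) that by blast
        ultimately show False by metis
      qed
      moreover have "(\<lambda>t. c (t * m)) ` {..<i} \<subseteq> c ` V" using tm ij by auto
      ultimately have "i \<le> s"
        using c(2) card_inj_on_le[of "\<lambda>t. c (t * m)" "{..<i}" "c ` V"] by (auto simp: V_def)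
      with \<open>s \<le> j\<close> show "s \<in> {i..j}" by simp
    qed
    show "{i..j} \<subseteq> feasible_set H"
    proof
      fix k assume k: "k \<in> {i..j}"
      \<comment> \<open>Only the blocks from number \<open>k - 1\<close> on are merged; as
        \<open>i <= k\<close>, the first \<open>i\<close> blocks keep distinct colours.\<close>
      define c where "c v = min (b v) (k - 1)" for v :: nat
      have "c ` V = (\<lambda>t. min t (k - 1)) ` {..<j}"
        unfolding c_def bV[symmetric] by (simp add: image_image)
      also have "\<dots> = {..<k}"
      proof
        show "(\<lambda>t. min t (k - 1)) ` {..<j} \<subseteq> {..<k}" using k ij by auto
        show "{..<k} \<subseteq> (\<lambda>t. min t (k - 1)) ` {..<j}"
        proof
          fix t assume "t \<in> {..<k}"
          then have "t = min t (k - 1)" "t \<in> {..<j}" using k by auto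
          then show "t \<in> (\<lambda>t. min t (k - 1)) ` {..<j}" by blast
        qed
      qed
      finally have "card (c ` V) = k" by simp
      moreover have "proper H c"
        unfolding proper_def
      proof (intro conjI ballI)
        fix E assume "E \<in> C_edges H"
        then have E: "card E = 2" "\<forall>u\<in>E. \<forall>v\<in>E. b u = b v"
          unfolding H_def mixed_hypergraph.simps by blast+
        then obtain u v where "E = {u, v}" "u \<noteq> v" by (meson card_2_iff)
        moreover from this have "c u = c v" using E(2) unfolding c_def by (metis insertI1 insertI2)
        ultimately show "\<exists>u\<in>E. \<exists>v\<in>E. u \<noteq> v \<and> c u = c v" by blast
      next
        fix E assume "E \<in> D_edges H"
        then obtain u v where "u \<in> E" "v \<in> E" "b u < i" "b v < i" "b u \<noteq> b v"
          by (auto simp: H_def)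
        then show "\<exists>u\<in>E. \<exists>v\<in>E. c u \<noteq> c v"
          using k by (intro bexI[of _ u] bexI[of _ v]) (auto simp: c_def)
      qed
      ultimately show "k \<in> feasible_set H" by (intro feasible_setI[OF mH]) (auto simp: H_def)
    qed
  qed
  moreover have "1 \<le> card V" using j0 m by (simp add: V_def)
  ultimately show ?thesis using mH ne ij by (intro exI[of _ H]) (auto simp: H_def uniform_def)
qed

section \<open>Rigidity of grids\<close>

text \<open>The hypotheses \<open>rainbow\<close>, \<open>mono\<close> and \<open>third\<close> are
  what C-edges, D-edges and the presence of three colours will provide. Two neighbours of distinct
  colours single out a direction \<open>i\<close>; all slices in that direction turn out constant,
  and \<open>mono\<close> keeps their colours apart.\<close>

lemma grid_rigid:
  fixes G :: "('i \<Rightarrow> nat) \<Rightarrow> nat" and n :: "'i \<Rightarrow> nat" and I :: "'i set"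
  assumes X_def: "X = {x. \<forall>i\<in>I. x i < n i}"
    and I: "finite I"
    and n: "\<And>i. i \<in> I \<Longrightarrow> 2 \<le> n i"
    and rainbow: "\<And>x y z. x \<in> X \<Longrightarrow> y \<in> X \<Longrightarrow> z \<in> X \<Longrightarrow> G x \<noteq> G y \<Longrightarrow> G z \<notin> {G x, G y} \<Longrightarrow>
      \<exists>i\<in>I. x i \<noteq> y i \<and> z i \<notin> {x i, y i}"
    and mono: "\<And>x y. x \<in> X \<Longrightarrow> y \<in> X \<Longrightarrow> G x = G y \<Longrightarrow> \<exists>i\<in>I. x i = y i"
    and third: "\<And>p q. \<exists>x\<in>X. G x \<notin> {p, q}"
  shows "\<exists>i\<in>I. \<forall>x\<in>X. \<forall>y\<in>X. G x = G y \<longleftrightarrow> x i = y i"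
proof -
  \<comment> \<open>Points of \<open>X\<close> are arbitrary outside \<open>I\<close>. If the
    colours differed, a point of a third colour and \<open>rainbow\<close> would give a coordinate
    in \<open>I\<close> where \<open>x\<close> and \<open>y\<close> differ.\<close>
  have ext: "G x = G y" if "x \<in> X" "y \<in> X" "\<forall>k\<in>I. x k = y k" for x y
    using rainbow[of x y] third[of "G x" "G y"] that by blast
  \<comment> \<open>A point that differs from \<open>x\<close> in every coordinate, which
    contradicts \<open>mono\<close> as soon as the colours agree.\<close>
  define off where "off x k = (if x k = 0 then 1 else 0 :: nat)" for x :: "'i \<Rightarrow> nat" and k
  have off: "off x k \<noteq> x k" "k \<in> I \<Longrightarrow> off x k < n k" for x k
    using n[of k] by (auto simp: off_def)
  define adj where "adj i x y \<longleftrightarrow> i \<in> I \<and> x \<in> X \<and> y \<in> X \<and> (\<forall>k\<in>I - {i}. x k = y k) \<and> G x \<noteq> G y"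
    for i x y
  have adj_sym: "adj i y x" if "adj i x y" for i x y
    using that unfolding adj_def by auto
  have adj_neq: "x i \<noteq> y i" if "adj i x y" for i x y
    using that ext[of x y] unfolding adj_def by blast
  \<comment> \<open>As \<open>x\<close> and \<open>y\<close> differ in coordinate \<open>i\<close>
    only, \<open>rainbow\<close> admits a third colour only off their two slices.\<close>
  have two: "G z \<in> {G x, G y}" if "adj i x y" "z \<in> X" "z i \<in> {x i, y i}" for i x y z
    using that rainbow[of x y z] unfolding adj_def by blast
  \<comment> \<open>If the change in coordinate \<open>j\<close> altered the colour, a point
    \<open>z\<close> of a third colour would differ from both ends in that coordinate. The point
    \<open>w\<close> built from it differs from both ends everywhere, so \<open>mono\<close> denies
    it their colours; but \<open>two\<close> leaves only \<open>G x\<close> and \<open>G y\<close>,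
    which the ends already use up.\<close>
  have upd: "G (x(j := t)) = G x" if a: "adj i x y" and j: "j \<in> I" "j \<noteq> i" "t < n j" for i x y j t
  proof (rule ccontr)
    let ?x = "x(j := t)"
    assume ne: "G ?x \<noteq> G x"
    have X: "x \<in> X" "?x \<in> X" "y \<in> X" "i \<in> I" using a j unfolding adj_def X_def by auto
    have aj: "adj j x ?x" using X j ne unfolding adj_def by auto
    obtain z where z: "z \<in> X" "G z \<notin> {G x, G ?x}" using third by blast
    then have zj: "z j \<noteq> x j" "z j \<noteq> t" using two[OF aj, of z] by auto
    define w where "w k = (if k = i then y i else if k = j then z j else off x k)" for k
    have wX: "w \<in> X" using X z j off unfolding w_def X_def by auto
    have w: "w k \<noteq> x k \<and> w k \<noteq> ?x k" for k
      using adj_neq[OF a] zj off(1)[of x k] j(2) by (cases "k = i"; cases "k = j") (simp_all add: w_def)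
    have "G w \<noteq> G x" "G w \<noteq> G ?x" using mono[OF wX X(1)] mono[OF wX X(2)] w by blast+
    moreover have "G w \<in> {G x, G y}" using two[OF a wX] by (simp add: w_def)
    moreover have "G ?x \<in> {G x, G y}" using two[OF a X(2)] j by simp
    ultimately show False using ne by auto
  qed
  \<comment> \<open>The coordinates other than \<open>i\<close> are changed one at a time, in
    \<open>x\<close> and \<open>y\<close> simultaneously, so that the pair remains adjacent and
    \<open>upd\<close> stays applicable.\<close>
  have slice_aux: "G x' = G x"
    if "finite J" "J \<subseteq> I - {i}" "adj i x y" "x' \<in> X" "\<forall>k\<in>I - J. x' k = x k" for J i x y x'
    using that
  proof (induction J arbitrary: x y rule: finite_induct)
    case empty
    then show ?case using ext[of x' x] unfolding adj_def by auto
  next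
    case (insert j J)
    have j: "j \<in> I" "j \<noteq> i" "x' j < n j" using insert.prems unfolding X_def by auto
    have eq: "G (x(j := x' j)) = G x" "G (y(j := x' j)) = G y"
      using upd[OF insert.prems(2) j] upd[OF adj_sym[OF insert.prems(2)] j] by simp_all
    have "adj i (x(j := x' j)) (y(j := x' j))"
      using insert.prems(2) eq j unfolding adj_def X_def by auto
    then have "G x' = G (x(j := x' j))"
      by (rule insert.IH[rotated]) (use insert.prems in auto)
    then show ?case using eq by simp
  qed
  have slice: "G x' = G x" if "adj i x y" "x' \<in> X" "x' i = x i" for i x y x'
    using slice_aux[of "I - {i}" i x y x'] that I unfolding adj_def by auto
  \<comment> \<open>Otherwise changing coordinates one by one never alters the colour, and
    \<open>G\<close> is constant, against \<open>third\<close>.\<close>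
  have "\<exists>i x y. adj i x y"
  proof (rule ccontr)
    assume no: "\<not> (\<exists>i x y. adj i x y)"
    have const: "G x = G y" if "finite J" "J \<subseteq> I" "x \<in> X" "y \<in> X" "\<forall>k\<in>I - J. x k = y k" for J x y
      using that
    proof (induction J arbitrary: x rule: finite_induct)
      case empty
      then show ?case using ext[of x y] by simp
    next
      case (insert j J)
      have X: "x(j := y j) \<in> X" using insert.prems unfolding X_def by auto
      have "G (x(j := y j)) = G y"
      proof (rule insert.IH)
        show "x(j := y j) \<in> X" "y \<in> X" "J \<subseteq> I" using X insert.prems by simp_all
        show "\<forall>k\<in>I - J. (x(j := y j)) k = y k" using insert.prems by simp
      qed
      moreover have "G x = G (x(j := y j))"
        using no[unfolded adj_def, simplified, rule_format, of j x "x(j := y j)"] X insert.prems by auto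
      ultimately show ?case by simp
    qed
    obtain x where "x \<in> X" using third by blast
    moreover obtain y where "y \<in> X" "G y \<noteq> G x" using third by blast
    ultimately show False using const[OF I order_refl, of y x] by simp
  qed
  then obtain i x y where a: "adj i x y" by blast
  then have i: "i \<in> I" "x \<in> X" unfolding adj_def by auto
  \<comment> \<open>Shifted to the slice of \<open>x\<close>, the point \<open>z\<close> gets the
    colour \<open>G x\<close>. So \<open>z\<close> and its shift are adjacent, and
    \<open>slice\<close> applies to the slice of \<open>z\<close>.\<close>
  have slices1: "G z' = G z" if "z \<in> X" "z' \<in> X" "z i = z' i" "G z \<noteq> G x" for z z'
  proof -
    let ?z = "z(i := x i)"
    have zX: "?z \<in> X" using i that unfolding X_def by auto
    then have "G ?z = G x" using slice[OF a, of ?z] by simp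
    then have "adj i z ?z" using that zX i unfolding adj_def by auto
    then show ?thesis using slice that by metis
  qed
  have slices: "G z' = G z" if "z \<in> X" "z' \<in> X" "z i = z' i" for z z'
    using slices1[of z z'] slices1[of z' z] that by metis
  have "z i = z' i" if z: "z \<in> X" "z' \<in> X" "G z = G z'" for z z'
  proof (rule ccontr)
    assume ne: "z i \<noteq> z' i"
    \<comment> \<open>By \<open>slices\<close> this point has the colour of \<open>z'\<close>, hence
      that of \<open>z\<close>, yet it differs from \<open>z\<close> in every coordinate.\<close>
    define w where "w k = (if k = i then z' i else off z k)" for k
    have wX: "w \<in> X" using z off unfolding w_def X_def by auto
    have "G w = G z" using slices[OF z(2) wX] z by (simp add: w_def)
    then obtain k where "w k = z k" using mono[OF wX z(1)] by blast
    then show False using ne off(1)[of z k] by (auto simp: w_def split: if_splits)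
  qed
  then show ?thesis using i slices by metis
qed

section \<open>The hypergraph spanned by coordinate colorings\<close>

lemma exists_card_between:
  assumes "finite B" "A \<subseteq> B" "card A \<le> k" "k \<le> card B"
  obtains E where "A \<subseteq> E" "E \<subseteq> B" "card E = k"
  using exists_subset_between[OF assms(3,4,2,1)] by blast

text \<open>One vertex for each remaining colour extends \<open>u\<close>, \<open>v\<close>,
  \<open>w\<close> to a rainbow set with all colours, which is then cut down to \<open>l\<close>
  elements.\<close>

lemma rainbow_subset:
  assumes "finite V" "u \<in> V" "v \<in> V" "w \<in> V" "c u \<noteq> c v" "c w \<notin> {c u, c v}"
    and "3 \<le> l" "l \<le> card (c ` V)"
  obtains E where "{u, v, w} \<subseteq> E" "E \<subseteq> V" "card E = l" "inj_on c E"
proof -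
  obtain T where T: "T \<subseteq> V" "inj_on c T" "c ` T = c ` V - {c u, c v, c w}"
    using subset_image_inj[of "c ` V - {c u, c v, c w}" c V] by auto
  let ?B = "{u, v, w} \<union> T"
  have "inj_on c {u, v, w}" using assms(5,6) by auto
  moreover have "c ` {u, v, w} \<inter> c ` T = {}" using T(3) by auto
  ultimately have "inj_on c ?B" unfolding inj_on_Un using T(2) by blast
  moreover have "c ` ?B = c ` V" using T assms(2-4) by auto
  ultimately have "l \<le> card ?B" using assms(8) card_image by metis
  moreover have "finite ?B" using T(1) assms(1) finite_subset by auto
  moreover have "card {u, v, w} \<le> l" using assms(7) by (simp add: card_insert_if)
  ultimately obtain E where "{u, v, w} \<subseteq> E" "E \<subseteq> ?B" "card E = l"
    using exists_card_between[of ?B "{u, v, w}" l] by blast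
  moreover have "?B \<subseteq> V" using T(1) assms(2-4) by blast
  ultimately show thesis using that[of E] inj_on_subset[OF \<open>inj_on c ?B\<close>] by blast
qed

text \<open>\<open>f i v\<close> is the \<open>i\<close>-th coordinate of \<open>v\<close>. The
  fibre size \<open>l * m\<close> ensures that with fewer than \<open>l\<close> colours some colour
  occurs \<open>m\<close> times on each fibre. An empty \<open>I\<close> is allowed and realises the
  empty feasible set.\<close>

locale grid_coloring =
  fixes V :: "'a set" and I :: "'i set" and n :: "'i \<Rightarrow> nat" and f :: "'i \<Rightarrow> 'a \<Rightarrow> nat" and l m :: nat
  assumes finV: "finite V" and finI: "finite I" and l: "3 \<le> l" and m: "2 \<le> m"
    and n: "i \<in> I \<Longrightarrow> 2 \<le> n i"
    and f_less: "i \<in> I \<Longrightarrow> v \<in> V \<Longrightarrow> f i v < n i"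
    and fibre: "(\<And>i. i \<in> I \<Longrightarrow> x i < n i) \<Longrightarrow> l * m \<le> card {v \<in> V. \<forall>i\<in>I. f i v = x i}"
begin

text \<open>These are all edges of the given sizes that every coordinate coloring satisfies, so
  other colorings are constrained as much as possible.\<close>

definition H :: "'a mixed_hypergraph" where
  "H = \<lparr>verts = V,
        C_edges = {E. E \<subseteq> V \<and> card E = l \<and> (\<forall>i\<in>I. \<not> inj_on (f i) E)},
        D_edges = {E. E \<subseteq> V \<and> card E = m \<and> (\<forall>i\<in>I. \<exists>u\<in>E. \<exists>v\<in>E. f i u \<noteq> f i v)}\<rparr>"

lemma verts_H [simp]: "verts H = V"
  by (simp add: H_def)

lemma mixed_hypergraph_H: "mixed_hypergraph H"
  using finV by (auto simp: H_def mixed_hypergraph_def)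

lemma uniform_H: "uniform l m H"
  by (auto simp: H_def uniform_def)

definition grid :: "('i \<Rightarrow> nat) set" where
  "grid = {x. \<forall>i\<in>I. x i < n i}"

definition blob :: "('i \<Rightarrow> nat) \<Rightarrow> 'a set" where
  "blob x = {v \<in> V. \<forall>i\<in>I. f i v = x i}"

lemma blob_sub: "blob x \<subseteq> V"
  by (auto simp: blob_def)

lemma finite_blob: "finite (blob x)"
  using finV blob_sub finite_subset by blast

lemma card_blob: "x \<in> grid \<Longrightarrow> l * m \<le> card (blob x)"
  using fibre[of x] by (auto simp: grid_def blob_def)

lemma blob_nonempty: "x \<in> grid \<Longrightarrow> blob x \<noteq> {}"
  using card_blob[of x] l m by auto

lemma zero_grid: "(\<lambda>_. 0) \<in> grid"
  using n by (force simp: grid_def)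

lemma card_V: "l * m \<le> card V"
  using card_blob[OF zero_grid] card_mono[OF finV blob_sub] le_trans by blast

lemma nonempty_H: "nonempty H"
proof -
  have "l \<le> l * m" using m by simp
  then obtain E where E: "E \<subseteq> blob (\<lambda>_. 0)" "card E = l"
    using card_blob[OF zero_grid] obtain_subset_with_card_n le_trans by metis
  obtain u v where "u \<in> E" "v \<in> E" "u \<noteq> v"
    using E(2) l card_le_Suc0_iff_eq[of E] card.infinite[of E] by force
  moreover have "f i u = f i v" if "i \<in> I" for i
    using that E(1) \<open>u \<in> E\<close> \<open>v \<in> E\<close> by (auto simp: blob_def subset_iff)
  ultimately have "\<forall>i\<in>I. \<not> inj_on (f i) E" by (meson inj_onD)
  then have "E \<in> C_edges H" using E blob_sub by (auto simp: H_def)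
  then show ?thesis by (auto simp: nonempty_def)
qed

lemma proper_coord:
  assumes "i \<in> I"
  shows "proper H (f i)"
  using assms unfolding proper_def H_def inj_on_def by fastforce

lemma coord_image:
  assumes "i \<in> I"
  shows "f i ` V = {..<n i}"
proof
  show "f i ` V \<subseteq> {..<n i}" using f_less assms by auto
  show "{..<n i} \<subseteq> f i ` V"
  proof
    fix t assume t: "t \<in> {..<n i}"
    have "(\<lambda>k. if k = i then t else 0) \<in> grid" using t n by (force simp: grid_def)
    then obtain v where "v \<in> blob (\<lambda>k. if k = i then t else 0)" using blob_nonempty by blast
    then show "t \<in> f i ` V" using assms by (force simp: blob_def)
  qed
qed

lemma card_coord_image: "i \<in> I \<Longrightarrow> card (f i ` V) = n i"
  by (simp add: coord_image)

section \<open>Rigidity of proper colorings\<close>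

lemma proper_rainbow:
  assumes c: "proper H c" "l \<le> card (c ` V)"
    and "u \<in> V" "v \<in> V" "w \<in> V" "c u \<noteq> c v" "c w \<notin> {c u, c v}"
  shows "\<exists>i\<in>I. f i u \<noteq> f i v \<and> f i w \<notin> {f i u, f i v}"
proof -
  obtain E where E: "{u, v, w} \<subseteq> E" "E \<subseteq> V" "card E = l" "inj_on c E"
    using rainbow_subset[OF finV assms(3-7) l assms(2)] .
  \<comment> \<open>A rainbow set under a proper coloring is no C-edge, so some coordinate is
    injective on it.\<close>
  have "E \<notin> C_edges H"
  proof
    assume "E \<in> C_edges H"
    then obtain a b where "a \<in> E" "b \<in> E" "a \<noteq> b" "c a = c b"
      using c(1) unfolding proper_def by blast
    then show False using E(4) by (auto simp: inj_on_def)
  qed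
  then obtain i where i: "i \<in> I" "inj_on (f i) E" using E by (auto simp: H_def)
  have "u \<noteq> v" "w \<noteq> u" "w \<noteq> v" using assms by auto
  then show ?thesis using E(1) i by (intro bexI[of _ i]) (auto simp: inj_on_def)
qed

text \<open>Otherwise an \<open>m\<close>-subset of \<open>W\<close> through \<open>u\<close> and
  \<open>v\<close> is non-constant in every coordinate, thus a monochromatic D-edge.\<close>

lemma no_mono_across:
  assumes c: "proper H c" and W: "W \<subseteq> V" "\<And>w. w \<in> W \<Longrightarrow> c w = p" "m \<le> card W"
    and uv: "u \<in> W" "v \<in> W"
  shows "\<exists>i\<in>I. f i u = f i v"
proof (rule ccontr)
  assume no: "\<not> (\<exists>i\<in>I. f i u = f i v)"
  have "card {u, v} \<le> m" using m by (simp add: card_insert_if)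
  moreover have "finite W" using W(1) finV finite_subset by blast
  ultimately obtain E where E: "{u, v} \<subseteq> E" "E \<subseteq> W" "card E = m"
    using exists_card_between[of W "{u, v}" m] uv W(3) by blast
  have "\<forall>i\<in>I. \<exists>a\<in>E. \<exists>b\<in>E. f i a \<noteq> f i b" using no E(1) by blast
  then have "E \<in> D_edges H" using E W(1) by (auto simp: H_def)
  then obtain a b where "a \<in> E" "b \<in> E" "c a \<noteq> c b" using c unfolding proper_def by blast
  then show False using E(2) W(2) by (metis subsetD)
qed

lemma ex_third:
  assumes "l \<le> card (c ` V)"
  shows "\<exists>w\<in>V. c w \<notin> {p, q}"
proof (rule ccontr)
  assume "\<not> ?thesis"
  then have "c ` V \<subseteq> {p, q}" by blast
  then have "card (c ` V) \<le> card {p, q}" by (intro card_mono) auto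
  also have "\<dots> \<le> 2" by (simp add: card_insert_if)
  finally show False using assms l by linarith
qed

text \<open>Together with a vertex of a third colour, \<open>proper_rainbow\<close> would separate
  \<open>u\<close> and \<open>v\<close> in some coordinate.\<close>

lemma const_on_blob:
  assumes c: "proper H c" "l \<le> card (c ` V)" and uv: "u \<in> V" "v \<in> V" "\<forall>i\<in>I. f i u = f i v"
  shows "c u = c v"
proof (rule ccontr)
  assume ne: "c u \<noteq> c v"
  obtain w where "w \<in> V" "c w \<notin> {c u, c v}" using ex_third[OF c(2)] by blast
  then show False using proper_rainbow[OF c uv(1,2) _ ne] uv(3) by blast
qed

text \<open>One vertex per blob turns \<open>c\<close> into a coloring of the grid, to which
  \<open>grid_rigid\<close> applies; by \<open>const_on_blob\<close> the choice is
  immaterial.\<close>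

lemma coloring_is_coord:
  assumes c: "proper H c" "l \<le> card (c ` V)"
  obtains i where "i \<in> I" "\<And>u v. u \<in> V \<Longrightarrow> v \<in> V \<Longrightarrow> c u = c v \<longleftrightarrow> f i u = f i v"
proof -
  define pt where "pt x = (SOME v. v \<in> blob x)" for x
  have pt: "pt x \<in> blob x" if "x \<in> grid" for x
    using blob_nonempty[OF that] unfolding pt_def by (simp add: some_in_eq)
  then have ptV: "pt x \<in> V" and fpt: "\<And>i. i \<in> I \<Longrightarrow> f i (pt x) = x i" if "x \<in> grid" for x
    using that by (auto simp: blob_def)
  have coords: "(\<lambda>i. f i v) \<in> grid" if "v \<in> V" for v
    using that f_less by (simp add: grid_def)
  have c_pt: "c (pt (\<lambda>i. f i v)) = c v" if "v \<in> V" for v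
    using const_on_blob[OF c] that ptV fpt coords by blast
  have "\<exists>i\<in>I. \<forall>x\<in>grid. \<forall>y\<in>grid. c (pt x) = c (pt y) \<longleftrightarrow> x i = y i"
  proof (rule grid_rigid[OF grid_def finI n])
    fix x y z
    assume xyz: "x \<in> grid" "y \<in> grid" "z \<in> grid"
      "c (pt x) \<noteq> c (pt y)" "c (pt z) \<notin> {c (pt x), c (pt y)}"
    then show "\<exists>i\<in>I. x i \<noteq> y i \<and> z i \<notin> {x i, y i}"
      using proper_rainbow[OF c ptV ptV ptV xyz(4,5)] fpt by auto
  next
    fix x y assume xy: "x \<in> grid" "y \<in> grid" "c (pt x) = c (pt y)"
    \<comment> \<open>Two blobs of the same colour have a monochromatic union with at least
      \<open>m\<close> vertices, as \<open>no_mono_across\<close> requires.\<close>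
    have "c w = c (pt x)" if w: "w \<in> blob x \<union> blob y" for w
    proof (cases "w \<in> blob x")
      case True
      then show ?thesis
        using const_on_blob[OF c, of w "pt x"] xy pt[of x] by (auto simp: blob_def)
    next
      case False
      then have "w \<in> blob y" using w by blast
      then show ?thesis
        using const_on_blob[OF c, of w "pt y"] xy pt[of y] by (auto simp: blob_def)
    qed
    moreover have "m \<le> card (blob x \<union> blob y)"
    proof -
      have "m \<le> l * m" using l by simp
      also have "\<dots> \<le> card (blob x)" using card_blob xy by blast
      also have "\<dots> \<le> card (blob x \<union> blob y)" by (intro card_mono) (auto simp: finite_blob)
      finally show ?thesis .
    qed
    ultimately have "\<exists>i\<in>I. f i (pt x) = f i (pt y)"
      using no_mono_across[OF c(1), of "blob x \<union> blob y"] blob_sub pt xy by blast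
    then show "\<exists>i\<in>I. x i = y i" using fpt xy by auto
  next
    fix p q
    obtain w where "w \<in> V" "c w \<notin> {p, q}" using ex_third[OF c(2)] by blast
    then show "\<exists>x\<in>grid. c (pt x) \<notin> {p, q}" using c_pt coords by metis
  qed
  then obtain i where i: "i \<in> I" "\<forall>x\<in>grid. \<forall>y\<in>grid. c (pt x) = c (pt y) \<longleftrightarrow> x i = y i"
    by blast
  then show thesis using that[of i] c_pt coords by metis
qed

text \<open>A coloring with fewer than \<open>l\<close> colours uses some colour \<open>m\<close> times on every blob; on the
  diagonal blobs these popular colours are distinct.\<close>

lemma few_colors:
  assumes c: "proper H c" "card (c ` V) < l"
  shows "\<exists>i\<in>I. n i \<le> card (c ` V)"
proof (rule ccontr)
  assume "\<not> ?thesis"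
  then have big: "card (c ` V) < n i" if "i \<in> I" for i using that by force
  have "\<exists>p\<in>c ` V. m \<le> card {v \<in> blob x. c v = p}" if x: "x \<in> grid" for x
  proof (rule ccontr)
    assume "\<not> ?thesis"
    \<comment> \<open>The weak bound suffices, since strictness comes from having fewer than
      \<open>l\<close> colours.\<close>
    then have small: "card {v \<in> blob x. c v = p} \<le> m" if "p \<in> c ` V" for p
      using that by force
    have "blob x = (\<Union>p\<in>c ` V. {v \<in> blob x. c v = p})" using blob_sub by auto
    then have "card (blob x) \<le> (\<Sum>p\<in>c ` V. card {v \<in> blob x. c v = p})"
      using card_UN_le[of "c ` V" "\<lambda>p. {v \<in> blob x. c v = p}"] finV by simp
    also have "\<dots> \<le> card (c ` V) * m"
      using sum_bounded_above[of "c ` V" _ m] small by fastforce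
    also have "\<dots> < l * m" using c(2) m by simp
    finally show False using card_blob[OF x] by linarith
  qed
  then obtain p where p: "\<And>x. x \<in> grid \<Longrightarrow> p x \<in> c ` V"
    "\<And>x. x \<in> grid \<Longrightarrow> m \<le> card {v \<in> blob x. c v = p x}"
    by metis
  \<comment> \<open>All ranges exceed the number of colours, so the grid contains one more of these
    diagonal points than there are colours, and two popular colours coincide.\<close>
  define d where "d t = (\<lambda>_::'i. t)" for t :: nat
  have d: "d t \<in> grid" if "t \<le> card (c ` V)" for t
    using that big by (force simp: d_def grid_def)
  have "(\<lambda>t. p (d t)) ` {..card (c ` V)} \<subseteq> c ` V" using p(1) d by auto
  then have "card ((\<lambda>t. p (d t)) ` {..card (c ` V)}) \<le> card (c ` V)"
    using finV by (intro card_mono) auto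
  then have "\<not> inj_on (\<lambda>t. p (d t)) {..card (c ` V)}"
    using card_image[of "\<lambda>t. p (d t)" "{..card (c ` V)}"] by auto
  then obtain s t where st: "s \<le> card (c ` V)" "t \<le> card (c ` V)" "s \<noteq> t" "p (d s) = p (d t)"
    by (auto simp: inj_on_def)
  let ?W = "\<lambda>t. {v \<in> blob (d t). c v = p (d t)}"
  have Ws: "m \<le> card (?W s)" "m \<le> card (?W t)" using p(2)[OF d[OF st(1)]] p(2)[OF d[OF st(2)]] .
  then have "?W s \<noteq> {}" "?W t \<noteq> {}"
    using m card.empty[where ?'a = 'a] by (metis le_zero_eq not_numeral_le_zero)+
  then obtain u v where uv: "u \<in> ?W s" "v \<in> ?W t" by blast
  have "card (?W s) \<le> card (?W s \<union> ?W t)" using finite_blob by (intro card_mono) auto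
  then have "\<exists>i\<in>I. f i u = f i v"
    using no_mono_across[OF c(1), of "?W s \<union> ?W t" "p (d s)" u v] blob_sub uv st Ws by fastforce
  then show False using uv st(3) by (auto simp: blob_def d_def)
qed

text \<open>The origin and the unit point in direction \<open>j\<close> agree in coordinate
  \<open>i\<close> unless \<open>i = j\<close>, but not in coordinate \<open>j\<close>.\<close>

lemma distinct_coords:
  assumes ij: "i \<in> I" "j \<in> I" and eq: "\<And>u v. u \<in> V \<Longrightarrow> v \<in> V \<Longrightarrow> f i u = f i v \<longleftrightarrow> f j u = f j v"
  shows "i = j"
proof (rule ccontr)
  assume ne: "i \<noteq> j"
  define e where "e = (\<lambda>k. if k = j then 1 else 0 :: nat)"
  have "e \<in> grid" using n by (force simp: grid_def e_def)
  then obtain u v where "u \<in> blob (\<lambda>_. 0)" "v \<in> blob e" using blob_nonempty zero_grid by blast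
  then show False using eq[of u v] ij ne by (auto simp: blob_def e_def)
qed

section \<open>Feasible set and number of colorings of the grid hypergraph\<close>

lemma feasible_coord: "i \<in> I \<Longrightarrow> n i \<in> feasible_set H"
  using feasible_setI[OF mixed_hypergraph_H proper_coord] card_coord_image by simp

lemma feasible_cases:
  assumes "s \<in> feasible_set H"
  shows "s \<in> n ` I \<or> s < l \<and> (\<exists>i\<in>I. n i \<le> s)"
proof -
  obtain c where c: "proper H c" "card (c ` V) = s" using feasible_setD[OF assms] by auto
  show ?thesis
  proof (cases "s < l")
    case True
    then show ?thesis using few_colors[OF c(1)] c(2) by auto
  next
    case False
    then obtain i where i: "i \<in> I" "\<And>u v. u \<in> V \<Longrightarrow> v \<in> V \<Longrightarrow> c u = c v \<longleftrightarrow> f i u = f i v"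
      using coloring_is_coord[OF c(1)] c(2) by auto
    have "card (c ` V) = card (f i ` V)"
      using isomorphic_colorings_card[of H c "f i"] i(2) by (simp add: isomorphic_colorings_iff)
    then show ?thesis using i(1) c(2) card_coord_image by auto
  qed
qed

text \<open>Sending a coordinate to its isomorphism class is injective by
  \<open>distinct_coords\<close> and, for \<open>l <= s\<close>, surjective by
  \<open>coloring_is_coord\<close>.\<close>

lemma num_colorings_H:
  assumes s: "l \<le> s"
  shows "num_colorings H s = card {i \<in> I. n i = s}"
proof -
  let ?P = "proper_colorings H s"
  let ?R = "{(c, c'). c \<in> ?P \<and> c' \<in> ?P \<and> isomorphic_colorings H c c'}"
  let ?col = "\<lambda>i. restrict (f i) V"
  have R: "equiv ?P ?R"
    by (intro equivI refl_onI symI transI) (auto simp: isomorphic_colorings_iff)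
  have col: "?col i \<in> ?P" if "i \<in> I" "n i = s" for i
    using that proper_coord card_coord_image proper_cong[OF mixed_hypergraph_H, of "f i" "?col i"]
    by (simp add: proper_colorings_def)
  have "bij_betw (\<lambda>i. ?R `` {?col i}) {i \<in> I. n i = s} (?P // ?R)"
    unfolding bij_betw_def
  proof
    show "inj_on (\<lambda>i. ?R `` {?col i}) {i \<in> I. n i = s}"
    proof (rule inj_onI)
      fix i j assume ij: "i \<in> {i \<in> I. n i = s}" "j \<in> {i \<in> I. n i = s}"
        and eq: "?R `` {?col i} = ?R `` {?col j}"
      have "(?col i, ?col j) \<in> ?R" using eq_equiv_class[OF eq R] col ij by blast
      then show "i = j" using ij by (intro distinct_coords) (auto simp: isomorphic_colorings_iff)
    qed
    show "(\<lambda>i. ?R `` {?col i}) ` {i \<in> I. n i = s} = ?P // ?R"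
    proof
      show "(\<lambda>i. ?R `` {?col i}) ` {i \<in> I. n i = s} \<subseteq> ?P // ?R"
        using col by (intro image_subsetI quotientI) simp
      show "?P // ?R \<subseteq> (\<lambda>i. ?R `` {?col i}) ` {i \<in> I. n i = s}"
      proof
        fix K assume "K \<in> ?P // ?R"
        then obtain c where c: "c \<in> ?P" "K = ?R `` {c}" by (rule quotientE)
        then have cp: "proper H c" "card (c ` V) = s" by (auto simp: proper_colorings_def)
        obtain i where i: "i \<in> I" "\<And>u v. u \<in> V \<Longrightarrow> v \<in> V \<Longrightarrow> c u = c v \<longleftrightarrow> f i u = f i v"
          using coloring_is_coord[OF cp(1)] cp(2) s by auto
        have "isomorphic_colorings H c (f i)" using i(2) by (simp add: isomorphic_colorings_iff)
        then have "n i = s" using isomorphic_colorings_card cp(2) card_coord_image i(1) by force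
        then have "(c, ?col i) \<in> ?R" using c(1) col i by (auto simp: isomorphic_colorings_iff)
        then have "K = ?R `` {?col i}" using equiv_class_eq[OF R] c(2) by blast
        then show "K \<in> (\<lambda>i. ?R `` {?col i}) ` {i \<in> I. n i = s}" using i(1) \<open>n i = s\<close> by blast
      qed
    qed
  qed
  then show ?thesis unfolding num_colorings_def by (rule bij_betw_same_card[symmetric])
qed

end

section \<open>The characterization\<close>

text \<open>The vertices are numbers that encode pairs of a grid point and one of
  \<open>l * m\<close> copies.\<close>

lemma ex_grid_coloring:
  assumes l: "3 \<le> l" and m: "2 \<le> m" and I: "finite I" and n: "\<And>i. i \<in> I \<Longrightarrow> 2 \<le> n i"
  obtains V :: "nat set" and f :: "'i \<Rightarrow> nat \<Rightarrow> nat" where "grid_coloring V I n f l m"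
proof -
  define X where "X = (\<Pi>\<^sub>E i\<in>I. {..<n i}) \<times> {..<l * m}"
  have finX: "finite X" unfolding X_def using I by (intro finite_cartesian_product finite_PiE) auto
  then obtain h where h: "bij_betw h {0..<card X} X" using ex_bij_betw_nat_finite by blast
  define f where "f i v = fst (h v) i" for i v
  have hX: "h v \<in> X" if "v \<in> {0..<card X}" for v using h that by (auto simp: bij_betw_def)
  have "grid_coloring {0..<card X} I n f l m"
  proof
    show "f i v < n i" if "i \<in> I" "v \<in> {0..<card X}" for i v
      using hX[OF that(2)] that(1) by (auto simp: X_def f_def PiE_def Pi_def)
    fix x assume x: "\<And>i. i \<in> I \<Longrightarrow> x i < n i"
    let ?F = "{v \<in> {0..<card X}. \<forall>i\<in>I. f i v = x i}"
    have "{restrict x I} \<times> {..<l * m} \<subseteq> h ` ?F"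
    proof
      fix y assume y: "y \<in> {restrict x I} \<times> {..<l * m}"
      then have "y \<in> X" using x by (auto simp: X_def)
      then obtain v where "v \<in> {0..<card X}" "y = h v" using bij_betw_imp_surj_on[OF h] by blast
      then show "y \<in> h ` ?F" using y by (auto simp: f_def)
    qed
    then have "card ({restrict x I} \<times> {..<l * m}) \<le> card ?F" by (intro surj_card_le) auto
    then show "l * m \<le> card ?F" by (simp add: card_cartesian_product)
  qed (use assms in auto)
  then show thesis using that by blast
qed

lemma ex_type_B3_B4:
  fixes r :: "nat \<Rightarrow> nat"
  assumes m: "2 \<le> m" and S: "finite S" "type_B3 l S \<or> type_B4 l S" and r: "\<forall>s\<in>S. r s \<noteq> 0"
  shows "\<exists>H :: nat mixed_hypergraph. mixed_hypergraph H \<and> nonempty H \<and> uniform l m H \<and>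
    l - 1 \<le> card (verts H) \<and> feasible_set H = S \<and> (\<forall>s\<in>S. l \<le> s \<longrightarrow> num_colorings H s = r s)"
proof -
  have l: "3 \<le> l" using S(2) by (auto simp: type_B3_def type_B4_def)
  have S2: "2 \<le> s" if "s \<in> S" for s
  proof -
    have "2 \<le> Min S" using S(2) l that by (auto simp: type_B3_def type_B4_def)
    then show ?thesis using Min_le[OF S(1) that] by linarith
  qed
  \<comment> \<open>Below \<open>l\<close>, \<open>feasible_cases\<close> leaves room for numbers
    that are no coordinate range; types B3 and B4 put all of these into \<open>S\<close>.\<close>
  have gap: "t \<in> S" if "s \<in> S" "s \<le> t" "t < l" for s t
  proof -
    have "Min S \<le> s" using Min_le[OF S(1) that(1)] .
    then have "t \<in> {Min S..l - 1}" "Min S < l" using that by auto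
    moreover have "{Min S..l - 1} \<subseteq> S"
      using S(2) that(1) \<open>Min S < l\<close> by (auto simp: type_B3_def type_B4_def)
    ultimately show ?thesis by blast
  qed
  \<comment> \<open>One coordinate of range \<open>s\<close> for each of the \<open>r s\<close>
    prescribed classes; as \<open>r s\<close> is non-zero, every \<open>s\<close> occurs.\<close>
  define I where "I = (SIGMA s:S. {..<r s})"
  have nI: "fst ` I = S" using r by (force simp: I_def)
  have "finite I" using S(1) by (simp add: I_def)
  moreover have "2 \<le> fst i" if "i \<in> I" for i using that S2 by (auto simp: I_def)
  ultimately obtain V :: "nat set" and f where "grid_coloring V I fst f l m"
    using ex_grid_coloring[OF l m] by blast
  then interpret grid_coloring V I fst f l m .
  have "feasible_set H = S"
  proof
    show "feasible_set H \<subseteq> S"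
    proof
      fix s assume "s \<in> feasible_set H"
      then show "s \<in> S" using feasible_cases[of s] nI gap by blast
    qed
    show "S \<subseteq> feasible_set H" using feasible_coord nI by blast
  qed
  moreover have "num_colorings H s = r s" if "s \<in> S" "l \<le> s" for s
  proof -
    have "{i \<in> I. fst i = s} = {s} \<times> {..<r s}" using that by (auto simp: I_def)
    then show ?thesis using num_colorings_H[OF that(2)] by (simp add: card_cartesian_product)
  qed
  moreover have "l - 1 \<le> card (verts H)"
  proof -
    have "l \<le> l * m" using m by simp
    then have "l \<le> card V" using card_V by (rule le_trans)
    then show ?thesis by simp
  qed
  ultimately show ?thesis using mixed_hypergraph_H nonempty_H uniform_H by blast
qed

lemma feasible_set_type:
  assumes H: "mixed_hypergraph H" "nonempty H" "uniform l m H" "l - 1 \<le> card (verts H)"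
    and l: "2 \<le> l" and m: "2 \<le> m" and S: "feasible_set H = S" "finite S"
  shows "type_B1 l S \<or> type_B2 l S \<or> type_B3 l S \<or> type_B4 l S"
proof -
  consider "l = 2" | "3 \<le> l" "S = {} \<or> l \<le> Min S" | "1 \<in> S"
    | "3 \<le> l" "S \<noteq> {}" "Min S < l" "1 \<notin> S"
    using l by linarith
  then show ?thesis
  proof cases
    case 1
    then show ?thesis using feasible_type_B2[OF H(1,2) _ m S] H(3) by simp
  next
    case 2
    then show ?thesis by (simp add: type_B3_def)
  next
    case 3
    then show ?thesis using feasible_one_type_B1[OF H l m S] by simp
  next
    case 4
    have Min: "Min S \<in> S" using S(2) 4 by simp
    then have "1 \<le> Min S" "Min S \<noteq> 1"
      using feasible_pos[OF H(1-3) l m] S(1) 4 by auto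
    then have "Min S \<in> {2..l - 1}" using 4 by auto
    moreover have "{Min S..l - 1} \<subseteq> S"
      using feasible_below_l[OF H(1,3,4), of "Min S"] Min S(1) l by auto
    ultimately show ?thesis using 4 unfolding type_B4_def by blast
  qed
qed

theorem theorem2:
  fixes l m :: nat and S :: "nat set"
  assumes "l \<ge> 2" and "m \<ge> 2" and "finite S"
  shows "((\<exists>H :: nat mixed_hypergraph.
             mixed_hypergraph H \<and> nonempty H \<and> uniform l m H \<and> l - 1 \<le> card (verts H) \<and>
             feasible_set H = S) \<longleftrightarrow>
           type_B1 l S \<or> type_B2 l S \<or> type_B3 l S \<or> type_B4 l S) \<and>
         (\<forall>r :: nat \<Rightarrow> nat. (\<forall>s\<in>S. r s \<noteq> 0) \<and> (type_B3 l S \<or> type_B4 l S) \<longrightarrow>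
           (\<exists>H :: nat mixed_hypergraph.
             mixed_hypergraph H \<and> nonempty H \<and> uniform l m H \<and> l - 1 \<le> card (verts H) \<and>
             feasible_set H = S \<and> (\<forall>s\<in>S. l \<le> s \<longrightarrow> num_colorings H s = r s)))"
    (is "(?ex \<longleftrightarrow> ?types) \<and> ?moreover")
proof
  have B34: ?moreover using ex_type_B3_B4[OF assms(2,3)] by blast
  then show ?moreover .
  show "?ex \<longleftrightarrow> ?types"
  proof
    assume ?ex
    then show ?types using feasible_set_type assms by metis
  next
    assume ?types
    then consider "type_B1 l S" | "l = 2" "type_B2 2 S" | "type_B3 l S \<or> type_B4 l S"
      by (auto simp: type_B2_def)
    then show ?ex
    proof cases
      case 1
      then show ?thesis by (rule ex_type_B1[OF assms(1)])
    next
      case 2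
      then show ?thesis using ex_type_B2[OF assms(2)] by simp
    next
      case 3
      \<comment> \<open>Any nowhere vanishing \<open>r\<close> serves here.\<close>
      then show ?thesis using ex_type_B3_B4[OF assms(2,3), of l "\<lambda>_. 1"] by auto
    qed
  qed
qed

end
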